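(* If $G$ and $H$ are connected graphs with $|G| \ge 2$ and $|H| \ge 2$, then $md(G \circ H) = 1$.
   Context: The lexicographic product $G \circ H$ has vertex set $V(G)\times V(H)$, with $(u,v)$ and $(u',v')$ adjacent if and only if either $uu' \in E(G)$, or $u=u'$ and $vv' \in E(H)$. $|G|$ is the number of vertices. An edge-coloring of a graph $G$ is a map $\Gamma: E(G) \to [k]$ (adjacent edges may receive the same color). An edge-cut is monochromatic if all of its edges have the same color. An edge-coloring of $G$ is a monochromatic disconnection coloring (MD-coloring) if any two distinct vertices $u,v$ of $G$ are separated by a monochromatic edge-cut (equivalently, for some color $i$, $u$ and $v$ lie in different components of the graph obtained by deleting all edges of color $i$). For a connected graph $G$, $md(G)$ is the maximum number of colors in an MD-coloring of $G$. *)

theory Defs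
  imports Main
begin

record 'a ugraph =
  verts :: "'a set"
  edges :: "'a set set"

definition simple_graph :: "'a ugraph \<Rightarrow> bool" where
  "simple_graph G \<longleftrightarrow>
     finite (verts G) \<and> (\<forall>e \<in> edges G. e \<subseteq> verts G \<and> card e = 2)"

definition adj :: "'a ugraph \<Rightarrow> ('a \<times> 'a) set" where
  "adj G = {(u, v). {u, v} \<in> edges G}"

definition same_component :: "'a ugraph \<Rightarrow> 'a \<Rightarrow> 'a \<Rightarrow> bool" where
  "same_component G u v \<longleftrightarrow> u \<in> verts G \<and> v \<in> verts G \<and> (u, v) \<in> (adj G)\<^sup>*"

definition connected_graph :: "'a ugraph \<Rightarrow> bool" where
  "connected_graph G \<longleftrightarrow>
     verts G \<noteq> {} \<and> (\<forall>u \<in> verts G. \<forall>v \<in> verts G. same_component G u v)"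

definition delete_edges :: "'a ugraph \<Rightarrow> 'a set set \<Rightarrow> 'a ugraph" where
  "delete_edges G F = \<lparr>verts = verts G, edges = edges G - F\<rparr>"

definition lex_product :: "'a ugraph \<Rightarrow> 'b ugraph \<Rightarrow> ('a \<times> 'b) ugraph" where
  "lex_product G H =
     \<lparr>verts = verts G \<times> verts H,
      edges = {{(u, v), (u', v')} | u v u' v'.
                 (u, v) \<in> verts G \<times> verts H \<and> (u', v') \<in> verts G \<times> verts H \<and>
                 ({u, u'} \<in> edges G \<or> u = u' \<and> {v, v'} \<in> edges H)}\<rparr>"

definition edge_coloring :: "'a ugraph \<Rightarrow> nat \<Rightarrow> ('a set \<Rightarrow> nat) \<Rightarrow> bool" where
  "edge_coloring G k \<Gamma> \<longleftrightarrow> \<Gamma> ` edges G \<subseteq> {1..k}"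

definition edge_cut :: "'a ugraph \<Rightarrow> 'a set set \<Rightarrow> bool" where
  "edge_cut G F \<longleftrightarrow> F \<subseteq> edges G \<and> \<not> connected_graph (delete_edges G F)"

definition monochromatic :: "('a set \<Rightarrow> nat) \<Rightarrow> 'a set set \<Rightarrow> bool" where
  "monochromatic \<Gamma> F \<longleftrightarrow> (\<exists>i. \<forall>e \<in> F. \<Gamma> e = i)"

definition MD_coloring :: "'a ugraph \<Rightarrow> nat \<Rightarrow> ('a set \<Rightarrow> nat) \<Rightarrow> bool" where
  "MD_coloring G k \<Gamma> \<longleftrightarrow> edge_coloring G k \<Gamma> \<and>
     (\<forall>u \<in> verts G. \<forall>v \<in> verts G. u \<noteq> v \<longrightarrow>
        (\<exists>F. edge_cut G F \<and> monochromatic \<Gamma> F \<and>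
             \<not> same_component (delete_edges G F) u v))"

text \<open>The number of colors of an MD-coloring is the number of colors that actually occur;
  the size \<open>k\<close> of the palette is irrelevant. The maximum is only meaningful for connected
  graphs, see \<open>md_well_defined\<close> below.\<close>

definition md :: "'a ugraph \<Rightarrow> nat" where
  "md G = Max {card (\<Gamma> ` edges G) | k \<Gamma>. MD_coloring G k \<Gamma>}"

lemma simple_graph_finite_edges: "simple_graph G \<Longrightarrow> finite (edges G)"
  by (rule finite_subset[of _ "Pow (verts G)"]) (auto simp: simple_graph_def)

lemma simple_graph_lex_product:
  assumes "simple_graph G" "simple_graph H"
  shows "simple_graph (lex_product G H)"
proof -
  have two: "card {(u, v), (u', v')} = 2"
    if "{u, u'} \<in> edges G \<or> u = u' \<and> {v, v'} \<in> edges H" for u v u' v'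
  proof -
    have "u \<noteq> u'" if "{u, u'} \<in> edges G"
      using that assms(1) by (auto simp: simple_graph_def)
    moreover have "v \<noteq> v'" if "{v, v'} \<in> edges H"
      using that assms(2) by (auto simp: simple_graph_def)
    ultimately show ?thesis
      using that by (auto simp: card_insert_if)
  qed
  have "finite (verts G \<times> verts H)"
    using assms by (simp add: simple_graph_def)
  moreover have "e \<subseteq> verts G \<times> verts H \<and> card e = 2" if "e \<in> edges (lex_product G H)" for e
  proof -
    from that obtain u v u' v' where e: "e = {(u, v), (u', v')}"
      "(u, v) \<in> verts G \<times> verts H" "(u', v') \<in> verts G \<times> verts H"
      "{u, u'} \<in> edges G \<or> u = u' \<and> {v, v'} \<in> edges H"
      unfolding lex_product_def by (simp only: ugraph.simps mem_Collect_eq) blast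
    from e(2,3) two[OF e(4)] show ?thesis
      unfolding e(1) by blast
  qed
  ultimately show ?thesis
    unfolding simple_graph_def[of "lex_product G H"] by (simp add: lex_product_def)
qed

lemma connected_graphD:
  "connected_graph G \<Longrightarrow> u \<in> verts G \<Longrightarrow> v \<in> verts G \<Longrightarrow> same_component G u v"
  by (simp add: connected_graph_def)

lemma MD_coloring_iff_color_class:
  assumes "connected_graph G"
  shows "MD_coloring G k \<Gamma> \<longleftrightarrow> edge_coloring G k \<Gamma> \<and>
     (\<forall>u \<in> verts G. \<forall>v \<in> verts G. u \<noteq> v \<longrightarrow>
        (\<exists>i \<in> {1..k}. \<not> same_component (delete_edges G {e \<in> edges G. \<Gamma> e = i}) u v))"
proof -
  have "(\<exists>F. edge_cut G F \<and> monochromatic \<Gamma> F \<and> \<not> same_component (delete_edges G F) u v) \<longleftrightarrow>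
        (\<exists>i \<in> {1..k}. \<not> same_component (delete_edges G {e \<in> edges G. \<Gamma> e = i}) u v)"
    (is "?L \<longleftrightarrow> ?R")
    if uv: "u \<in> verts G" "v \<in> verts G" and c: "edge_coloring G k \<Gamma>" for u v
  proof
    assume ?L
    then obtain F i where F: "F \<subseteq> edges G" "\<forall>e\<in>F. \<Gamma> e = i"
        "\<not> same_component (delete_edges G F) u v"
      by (auto simp: edge_cut_def monochromatic_def)
    have "delete_edges G {} = G"
      by (simp add: delete_edges_def)
    then have "F \<noteq> {}"
      using F(3) assms uv connected_graphD by metis
    then obtain e where "e \<in> F"
      by blast
    then have "e \<in> edges G" "\<Gamma> e = i"
      using F(1,2) by blast+
    then have i: "i \<in> {1..k}"
      using c unfolding edge_coloring_def by blast
    let ?C = "{e \<in> edges G. \<Gamma> e = i}"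
    have "F \<subseteq> ?C"
      using F(1,2) by blast
    then have "adj (delete_edges G ?C) \<subseteq> adj (delete_edges G F)"
      unfolding adj_def delete_edges_def by auto
    from rtrancl_mono[OF this] have "\<not> same_component (delete_edges G ?C) u v"
      using F(3) unfolding same_component_def by (auto simp: delete_edges_def)
    with i show ?R by (rule bexI[rotated])
  next
    assume ?R
    then obtain i where i: "\<not> same_component (delete_edges G {e \<in> edges G. \<Gamma> e = i}) u v"
      by (elim bexE)
    let ?C = "{e \<in> edges G. \<Gamma> e = i}"
    have "verts (delete_edges G ?C) = verts G"
      by (simp add: delete_edges_def)
    with uv have C: "u \<in> verts (delete_edges G ?C)" "v \<in> verts (delete_edges G ?C)"
      by simp_all
    have "\<not> connected_graph (delete_edges G ?C)"
      using i connected_graphD[OF _ C] by (rule contrapos_nn)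
    then have "edge_cut G ?C"
      unfolding edge_cut_def by simp
    moreover have "monochromatic \<Gamma> ?C"
      unfolding monochromatic_def by simp
    ultimately show ?L
      using i by (intro exI[of _ ?C] conjI) assumption+
  qed
  then show ?thesis
    unfolding MD_coloring_def by (intro conj_cong ball_cong imp_cong refl)
qed

lemma md_well_defined:
  assumes "simple_graph G" "connected_graph G"
  shows "finite {card (\<Gamma> ` edges G) | k \<Gamma>. MD_coloring G k \<Gamma>}"
    and "{card (\<Gamma> ` edges G) | k \<Gamma>. MD_coloring G k \<Gamma>} \<noteq> {}"
proof -
  have "card (\<Gamma> ` edges G) \<le> card (edges G)" for \<Gamma> :: "'a set \<Rightarrow> nat"
    using assms simple_graph_finite_edges card_image_le by blast
  then have "{card (\<Gamma> ` edges G) | k \<Gamma>. MD_coloring G k \<Gamma>} \<subseteq> {..card (edges G)}"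
    by auto
  then show "finite {card (\<Gamma> ` edges G) | k \<Gamma>. MD_coloring G k \<Gamma>}"
    by (rule finite_subset) (rule finite_atMost)
  have "adj (delete_edges G (edges G)) = {}"
    by (auto simp: adj_def delete_edges_def)
  then have "MD_coloring G 1 (\<lambda>_. 1)"
    by (subst MD_coloring_iff_color_class[OF assms(2)])
       (auto simp: edge_coloring_def same_component_def)
  then show "{card (\<Gamma> ` edges G) | k \<Gamma>. MD_coloring G k \<Gamma>} \<noteq> {}"
    by blast
qed

end

theory Submission imports Defs begin

text \<open>In an MD-coloring the color of an edge must recur on every cycle through that edge, so
  every triangle has a single color. In the lexicographic product, an edge \<open>{v, v'}\<close> of \<open>H\<close> placed
  over \<open>u\<close> forms a triangle with each vertex over a neighbour \<open>u'\<close> of \<open>u\<close>; moving such triangles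
  along walks in \<open>H\<close> gives one color to all edges over \<open>u\<close> and between \<open>u\<close> and \<open>u'\<close>, and
  walks in \<open>G\<close> then spread this color to the whole product.\<close>

lemma edge_verts:
  assumes "simple_graph K" "{u, v} \<in> edges K"
  shows "u \<in> verts K" "v \<in> verts K" "u \<noteq> v"
  using assms by (force simp: simple_graph_def)+

text \<open>Induction along a walk, packaged once: below, \<open>f\<close> is instantiated with edge
  colors as well as with truth values of reachability statements.\<close>

lemma connected_graph_const:
  assumes "connected_graph K" "u \<in> verts K" "v \<in> verts K"
    and step: "\<And>x y. {x, y} \<in> edges K \<Longrightarrow> f x = f y"
  shows "f u = f v"
proof -
  have "(u, v) \<in> (adj K)\<^sup>*"
    using connected_graphD[OF assms(1-3)] by (simp add: same_component_def)
  then show ?thesis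
    by induction (auto simp: adj_def dest: step)
qed

lemma connected_graph_ex_neighbour:
  assumes "connected_graph K" "card (verts K) \<ge> 2" "u \<in> verts K"
  shows "\<exists>v. {u, v} \<in> edges K"
proof -
  have "\<not> verts K \<subseteq> {u}"
    using card_mono[of "{u}" "verts K"] assms(2) by auto
  then obtain w where w: "w \<in> verts K" "w \<noteq> u"
    by blast
  have "(u, w) \<in> (adj K)\<^sup>*"
    using connected_graphD[OF assms(1,3) w(1)] by (simp add: same_component_def)
  then show ?thesis
    using w(2) by (cases rule: converse_rtranclE) (auto simp: adj_def)
qed

lemma verts_lex_product [simp]: "verts (lex_product G H) = verts G \<times> verts H"
  by (simp add: lex_product_def)

text \<open>An unordered pair may match the set comprehension with its ends swapped; the condition
  is symmetric in the two ends, so it can be read off in either order.\<close>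

lemma edges_lex_product_iff:
  "{(u, v), (u', v')} \<in> edges (lex_product G H) \<longleftrightarrow>
     u \<in> verts G \<and> v \<in> verts H \<and> u' \<in> verts G \<and> v' \<in> verts H \<and>
     ({u, u'} \<in> edges G \<or> u = u' \<and> {v, v'} \<in> edges H)"
  unfolding lex_product_def ugraph.simps mem_Collect_eq
  by (fastforce simp: doubleton_eq_iff insert_commute)

lemma edges_lex_productE:
  assumes "e \<in> edges (lex_product G H)"
  obtains u v u' v' where "e = {(u, v), (u', v')}" "u \<in> verts G" "v \<in> verts H"
    "u' \<in> verts G" "v' \<in> verts H" "{u, u'} \<in> edges G \<or> u = u' \<and> {v, v'} \<in> edges H"
  using assms unfolding lex_product_def ugraph.simps mem_Collect_eq by blast

text \<open>Walk in \<open>G\<close> with the second coordinate fixed, then in \<open>H\<close> with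
  the first one fixed.\<close>

lemma connected_graph_lex_product:
  assumes "simple_graph G" "connected_graph G" "simple_graph H" "connected_graph H"
  shows "connected_graph (lex_product G H)"
proof -
  have reach: "((u, v), (x, y)) \<in> (adj (lex_product G H))\<^sup>*" (is "_ \<in> ?R")
    if uv: "u \<in> verts G" "v \<in> verts H" "x \<in> verts G" "y \<in> verts H" for u v x y
  proof -
    have step: "((u, v), p) \<in> ?R \<longleftrightarrow> ((u, v), q) \<in> ?R"
      if "{p, q} \<in> edges (lex_product G H)" for p q
    proof -
      have "(p, q) \<in> adj (lex_product G H)" "(q, p) \<in> adj (lex_product G H)"
        using that by (simp_all add: adj_def insert_commute)
      then show ?thesis
        by (meson rtrancl.rtrancl_into_rtrancl)
    qed
    have "((u, v), (u, v)) \<in> ?R \<longleftrightarrow> ((u, v), (x, v)) \<in> ?R"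
    proof (rule connected_graph_const[OF assms(2) uv(1,3), where f = "\<lambda>p. ((u, v), (p, v)) \<in> ?R"])
      fix p q assume e: "{p, q} \<in> edges G"
      show "((u, v), (p, v)) \<in> ?R \<longleftrightarrow> ((u, v), (q, v)) \<in> ?R"
        by (rule step) (simp add: edges_lex_product_iff e uv edge_verts[OF assms(1) e])
    qed
    moreover have "((u, v), (x, v)) \<in> ?R \<longleftrightarrow> ((u, v), (x, y)) \<in> ?R"
    proof (rule connected_graph_const[OF assms(4) uv(2,4), where f = "\<lambda>p. ((u, v), (x, p)) \<in> ?R"])
      fix p q assume e: "{p, q} \<in> edges H"
      show "((u, v), (x, p)) \<in> ?R \<longleftrightarrow> ((u, v), (x, q)) \<in> ?R"
        by (rule step) (simp add: edges_lex_product_iff e uv edge_verts[OF assms(3) e])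
    qed
    ultimately show ?thesis
      by simp
  qed
  have "verts (lex_product G H) \<noteq> {}"
    using assms(2,4) by (simp add: connected_graph_def)
  then show ?thesis
    unfolding connected_graph_def same_component_def by (auto intro: reach)
qed

text \<open>A color class that separates the ends of an edge must contain that edge and also meet
  the path through the third vertex.\<close>

lemma MD_coloring_triangle:
  assumes "simple_graph K" "connected_graph K" "MD_coloring K k \<Gamma>"
    and "{a, b} \<in> edges K" "{b, c} \<in> edges K" "{a, c} \<in> edges K"
  shows "\<Gamma> {a, b} = \<Gamma> {a, c}"
proof -
  have recur: "\<Gamma> {x, y} = \<Gamma> {x, z} \<or> \<Gamma> {x, y} = \<Gamma> {z, y}"
    if xyz: "{x, y} \<in> edges K" "{x, z} \<in> edges K" "{z, y} \<in> edges K" for x y z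
  proof (rule ccontr)
    assume neq: "\<not> ?thesis"
    note xy = edge_verts[OF assms(1) xyz(1)]
    obtain i where i: "\<not> same_component (delete_edges K {e \<in> edges K. \<Gamma> e = i}) x y"
      using assms(3) xy unfolding MD_coloring_iff_color_class[OF assms(2)] by blast
    let ?A = "adj (delete_edges K {e \<in> edges K. \<Gamma> e = i})"
    have no: "(x, y) \<notin> ?A\<^sup>*"
      using i xy by (simp add: same_component_def delete_edges_def)
    then have "(x, y) \<notin> ?A"
      by blast
    then have "\<Gamma> {x, y} = i"
      using xyz(1) by (simp add: adj_def delete_edges_def)
    then have "(x, z) \<in> ?A" "(z, y) \<in> ?A"
      using neq xyz by (auto simp: adj_def delete_edges_def)
    then show False
      using no by (meson converse_rtrancl_into_rtrancl r_into_rtrancl)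
  qed
  \<comment> \<open>If neither instance gives the equality directly, both colors equal that of
    \<open>{b, c}\<close>.\<close>
  show ?thesis
    using recur[of a b c] recur[of a c b] assms(4-6) by (metis insert_commute)
qed

lemma MD_coloring_lex_product_const:
  assumes "simple_graph G" "connected_graph G" "card (verts G) \<ge> 2"
    and "simple_graph H" "connected_graph H" "card (verts H) \<ge> 2"
    and MD: "MD_coloring (lex_product G H) k \<Gamma>"
  shows "\<exists>c. \<forall>e \<in> edges (lex_product G H). \<Gamma> e = c"
proof -
  note triangle = MD_coloring_triangle[OF simple_graph_lex_product[OF assms(1,4)]
      connected_graph_lex_product[OF assms(1,2,4,5)] MD]
  note G = edge_verts[OF assms(1)] and H = edge_verts[OF assms(4)]
  obtain a where "a \<in> verts H"
    using assms(5) by (auto simp: connected_graph_def)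
  with connected_graph_ex_neighbour[OF assms(5,6)] obtain b where ab: "{a, b} \<in> edges H"
    by blast
  \<comment> \<open>The copy of one fixed edge of \<open>H\<close> over \<open>u\<close> supplies
    the reference color at \<open>u\<close>.\<close>
  define d where "d u = \<Gamma> {(u, a), (u, b)}" for u
  \<comment> \<open>The triangle is \<open>(u, v)\<close>, \<open>(u, v')\<close>,
    \<open>(u', w)\<close>; \<open>w\<close> is arbitrary, since an edge of \<open>G\<close> joins
    all vertices over its two ends.\<close>
  have fibre: "\<Gamma> {(u, v), (u, v')} = \<Gamma> {(u, v), (u', w)}"
    if "{u, u'} \<in> edges G" "{v, v'} \<in> edges H" "w \<in> verts H" for u u' v v' w
    by (rule triangle) (use that G[OF that(1)] H[OF that(2)] in \<open>simp_all add: edges_lex_product_iff\<close>)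
  have cross: "\<Gamma> {(u, v), (u', w)} = d u"
    if "{u, u'} \<in> edges G" "v \<in> verts H" "w \<in> verts H" for u u' v w
  proof -
    \<comment> \<open>With \<open>(u', w)\<close> fixed, the other end moves along \<open>H\<close>
      from \<open>v\<close> to \<open>a\<close>: consecutive cross edges lie in a triangle with the
      copy of \<open>{x, y}\<close> over \<open>u\<close>.\<close>
    have "\<Gamma> {(u, v), (u', w)} = \<Gamma> {(u, a), (u', w)}"
    proof (rule connected_graph_const[OF assms(5)])
      fix x y assume xy: "{x, y} \<in> edges H"
      then have yx: "{y, x} \<in> edges H"
        by (simp add: insert_commute)
      have "\<Gamma> {(u, x), (u', w)} = \<Gamma> {(u, x), (u, y)}"
        using fibre[OF that(1) xy that(3)] by simp
      also have "\<dots> = \<Gamma> {(u, y), (u', w)}"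
        using fibre[OF that(1) yx that(3)] by (simp add: insert_commute)
      finally show "\<Gamma> {(u, x), (u', w)} = \<Gamma> {(u, y), (u', w)}" .
    qed (use that H[OF ab] in auto)
    then show ?thesis
      using fibre[OF that(1) ab that(3)] by (simp add: d_def)
  qed
  \<comment> \<open>The edge between \<open>(u, a)\<close> and \<open>(u', a)\<close> has color
    \<open>d u\<close> seen from one end and \<open>d u'\<close> seen from the other.\<close>
  have d_step: "d u = d u'" if "{u, u'} \<in> edges G" for u u'
  proof -
    have "{u', u} \<in> edges G"
      using that by (simp add: insert_commute)
    from cross[OF this H(1)[OF ab] H(1)[OF ab]] cross[OF that H(1)[OF ab] H(1)[OF ab]] show ?thesis
      by (simp add: insert_commute)
  qed
  obtain r where r: "r \<in> verts G"
    using assms(2) by (auto simp: connected_graph_def)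
  have d_const: "d u = d r" if "u \<in> verts G" for u
    using connected_graph_const[OF assms(2) that r] d_step by blast
  have "\<Gamma> e = d r" if "e \<in> edges (lex_product G H)" for e
    using that
  proof (cases rule: edges_lex_productE)
    case (1 u v u' v')
    show ?thesis
    proof (cases "{u, u'} \<in> edges G")
      case True
      then show ?thesis
        using 1 cross d_const by simp
    next
      case False
      then have vv': "u = u'" "{v, v'} \<in> edges H"
        using 1 by auto
      \<comment> \<open>An edge inside a copy of \<open>H\<close> gets its color from a cross edge
        to any neighbouring copy.\<close>
      obtain x where "{u, x} \<in> edges G"
        using connected_graph_ex_neighbour[OF assms(2,3)] 1 by blast
      then show ?thesis
        using 1 vv' fibre cross d_const by simp
    qed
  qed
  then show ?thesis
    by blast
qed

theorem theorem4p6: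
  fixes G :: "'a ugraph" and H :: "'b ugraph"
  assumes "simple_graph G" and "connected_graph G" and "card (verts G) \<ge> 2"
    and "simple_graph H" and "connected_graph H" and "card (verts H) \<ge> 2"
  shows "md (lex_product G H) = 1"
proof -
  let ?P = "lex_product G H"
  let ?S = "{card (\<Gamma> ` edges ?P) | k \<Gamma>. MD_coloring ?P k \<Gamma>}"
  obtain u v where uv: "u \<in> verts G" "v \<in> verts H"
    using assms(2,5) by (auto simp: connected_graph_def)
  obtain u' where u': "{u, u'} \<in> edges G"
    using connected_graph_ex_neighbour[OF assms(2,3) uv(1)] by blast
  \<comment> \<open>Without an edge the image of the coloring would be empty and the count 0 instead
    of 1.\<close>
  have ne: "edges ?P \<noteq> {}"
    using uv u' edge_verts[OF assms(1) u'] edges_lex_product_iff[of u v u' v G H] by auto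
  have one: "card (\<Gamma> ` edges ?P) = 1" if MD: "MD_coloring ?P k \<Gamma>" for k \<Gamma>
  proof -
    obtain c where "\<forall>e \<in> edges ?P. \<Gamma> e = c"
      using MD_coloring_lex_product_const[OF assms MD] by blast
    with ne have "\<Gamma> ` edges ?P = {c}"
      by auto
    then show ?thesis
      by simp
  qed
  have "?S \<subseteq> {1}"
    using one by auto
  moreover have "?S \<noteq> {}"
    by (rule md_well_defined(2)[OF simple_graph_lex_product[OF assms(1,4)]
          connected_graph_lex_product[OF assms(1,2,4,5)]])
  ultimately have "?S = {1}"
    by (simp only: subset_singleton_iff simp_thms)
  then show ?thesis
    by (simp add: md_def)
qed

end
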